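(* Let $F$ be a field with $\operatorname{char}(F)\neq 2$ and let $A$ be a unital associative $F$-algebra such that $A=K(A)$, where $K(A)$ is the commutator ideal of $A$. Then for every associative $F$-algebra $B$, every surjective Jordan homomorphism $\varphi:A\to B$ is standard. Moreover, there exists an idempotent $\varepsilon$ in the center $Z(B)$ of $B$ such that $x\mapsto \varepsilon\varphi(x)$ is a homomorphism $A\to B$ and $x\mapsto (1-\varepsilon)\varphi(x)$ is an antihomomorphism $A\to B$.
   Context: Algebras are associative and not assumed unital unless stated (in the situation of the claim, $B$ is automatically unital, with unit $1$). $K(A)$ denotes the commutator ideal of $A$, i.e. the ideal of $A$ generated by all commutators $[x,y]=xy-yx$, $x,y\in A$. A Jordan homomorphism $\varphi:A\to B$ is an $F$-linear map with $\varphi(x\circ y)=\varphi(x)\circ\varphi(y)$ for all $x,y\in A$, where $x\circ y=xy+yx$. A Jordan homomorphism $\varphi:A\to B$ is called standard if there exist a homomorphism $\varphi_1:A\to B$ and an antihomomorphism $\varphi_2:A\to B$ such that $\varphi=\varphi_1+\varphi_2$ and $\varphi_1(A)\varphi_2(A)=\varphi_2(A)\varphi_1(A)=(0)$. (Homomorphisms and antihomomorphisms of algebras are $F$-linear and are not required to preserve units.) *)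

theory Defs
  imports Complex_Main
begin

text \<open>
  An algebra over a field is given by its scalar multiplication; the class \<open>ring\<close> supplies the
  associative, not necessarily unital, multiplication. In contrast to \<open>ring_1\<close> it does not exclude
  the zero algebra.
\<close>

locale assoc_algebra = vector_space scale
  for scale :: "'f::field \<Rightarrow> 'a::ring \<Rightarrow> 'a" +
  assumes scale_mult_left: "scale c x * y = scale c (x * y)"
    and scale_mult_right: "x * scale c y = scale c (x * y)"

definition is_identity :: "'a::ring \<Rightarrow> bool" where
  "is_identity e \<longleftrightarrow> (\<forall>x. e * x = x \<and> x * e = x)"

lemma is_identity_unique: "is_identity e \<Longrightarrow> is_identity e' \<Longrightarrow> e = e'"
  unfolding is_identity_def by metis

text \<open>A two-sided ideal of an algebra is required to be a linear subspace, not only a subgroup.\<close>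

definition algebra_ideal :: "('f::field \<Rightarrow> 'a::ring \<Rightarrow> 'a) \<Rightarrow> 'a set \<Rightarrow> bool" where
  "algebra_ideal scale I \<longleftrightarrow>
     module.subspace scale I \<and> (\<forall>a. \<forall>x\<in>I. a * x \<in> I \<and> x * a \<in> I)"

definition commutator_ideal :: "('f::field \<Rightarrow> 'a::ring \<Rightarrow> 'a) \<Rightarrow> 'a set" where
  "commutator_ideal scale = algebra_ideal scale hull {x * y - y * x | x y. True}"

definition ring_center :: "'a::ring set" where
  "ring_center = {z. \<forall>x. z * x = x * z}"

definition algebra_hom ::
  "('f::field \<Rightarrow> 'a::ring \<Rightarrow> 'a) \<Rightarrow> ('f \<Rightarrow> 'b::ring \<Rightarrow> 'b) \<Rightarrow> ('a \<Rightarrow> 'b) \<Rightarrow> bool" where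
  "algebra_hom sA sB f \<longleftrightarrow> Vector_Spaces.linear sA sB f \<and> (\<forall>x y. f (x * y) = f x * f y)"

definition algebra_antihom ::
  "('f::field \<Rightarrow> 'a::ring \<Rightarrow> 'a) \<Rightarrow> ('f \<Rightarrow> 'b::ring \<Rightarrow> 'b) \<Rightarrow> ('a \<Rightarrow> 'b) \<Rightarrow> bool" where
  "algebra_antihom sA sB f \<longleftrightarrow> Vector_Spaces.linear sA sB f \<and> (\<forall>x y. f (x * y) = f y * f x)"

definition jordan_prod :: "'a::ring \<Rightarrow> 'a \<Rightarrow> 'a" where
  "jordan_prod x y = x * y + y * x"

definition jordan_hom ::
  "('f::field \<Rightarrow> 'a::ring \<Rightarrow> 'a) \<Rightarrow> ('f \<Rightarrow> 'b::ring \<Rightarrow> 'b) \<Rightarrow> ('a \<Rightarrow> 'b) \<Rightarrow> bool" where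
  "jordan_hom sA sB f \<longleftrightarrow> Vector_Spaces.linear sA sB f \<and>
     (\<forall>x y. f (jordan_prod x y) = jordan_prod (f x) (f y))"

definition standard_jordan_hom ::
  "('f::field \<Rightarrow> 'a::ring \<Rightarrow> 'a) \<Rightarrow> ('f \<Rightarrow> 'b::ring \<Rightarrow> 'b) \<Rightarrow> ('a \<Rightarrow> 'b) \<Rightarrow> bool" where
  "standard_jordan_hom sA sB f \<longleftrightarrow> jordan_hom sA sB f \<and>
     (\<exists>f1 f2. algebra_hom sA sB f1 \<and> algebra_antihom sA sB f2 \<and>
        (\<forall>x. f x = f1 x + f2 x) \<and>
        (\<forall>x y. f1 x * f2 y = 0 \<and> f2 x * f1 y = 0))"

end

theory Submission
  imports Defs
begin

text \<open>
  Let \<open>f x y = \<phi> (x y) - \<phi> x \<phi> y\<close> and \<open>h x y = \<phi> (x y) - \<phi> y \<phi> x\<close> measure the failure of \<open>\<phi>\<close> to be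
  a homomorphism and an antihomomorphism. Classically \<open>h x y b f x y + f x y b h x y = 0\<close> for all
  \<open>b \<in> B\<close>, hence \<open>h x y b h x y c f x y = 0\<close>. Linearizing in \<open>x\<close> and \<open>y\<close> shows that a fixed number of
  factors \<open>h x y\<close>, interlaced with arbitrary elements of \<open>B\<close>, annihilates every \<open>f z w\<close>, and
  symmetrically. So every nonzero left ideal inside \<open>B h a b B f p q\<close> contains a nonzero left
  ideal annihilated by a given \<open>h x y\<close> or \<open>f x y\<close>. The elements with this property form an ideal
  \<open>E\<close> of \<open>B\<close>. Modulo \<open>E\<close> the map \<open>\<phi>\<close> is a homomorphism killing commutators, so \<open>A = K(A)\<close> forces
  \<open>E = B\<close>, whence \<open>h a b B f p q = 0\<close>. In the same way \<open>B\<close> is the sum of two ideals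
  annihilating each other, one containing all \<open>f x y\<close> and the other all \<open>h x y\<close>; the
  decomposition of \<open>1\<close> gives the central idempotent.
\<close>

section \<open>Words in one letter, interlaced with arbitrary factors\<close>

text \<open>Unfolded: all words \<open>p * u1 * p * u2 * ... * p * un * m\<close> vanish. The
  recursion exposes the letter next to \<open>m\<close> first, so it passes to left multiples of
  \<open>m\<close>.\<close>

primrec kills :: "'b::ring \<Rightarrow> nat \<Rightarrow> 'b \<Rightarrow> bool" where
  "kills p 0 m \<longleftrightarrow> m = 0"
| "kills p (Suc n) m \<longleftrightarrow> (\<forall>u. kills p n (p * u * m))"

lemma kills_zero: "kills p n 0"
  by (induction n) auto

lemma kills_diff: "kills p n m \<Longrightarrow> kills p n m' \<Longrightarrow> kills p n (m - m')"
  by (induction n arbitrary: m m') (auto simp: algebra_simps)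

lemma kills_mult_left: "kills p n m \<Longrightarrow> kills p n (v * m)"
proof (cases n)
  case (Suc k)
  assume "kills p n m"
  then have "kills p k (p * (u * v) * m)" for u
    using Suc by simp
  then show ?thesis
    using Suc by (simp add: mult.assoc)
qed simp

lemma kills_mult_right: "kills p n m \<Longrightarrow> kills p n (m * v)"
  by (induction n arbitrary: m) (auto simp flip: mult.assoc)

text \<open>Pigeonhole: in the expansion of a word with \<open>i + j + 1\<close> letters
  \<open>a - b\<close>, each term has at least \<open>i + 1\<close> letters \<open>a\<close> or at
  least \<open>j + 1\<close> letters \<open>b\<close>.\<close>

lemma kills_diff_letter:
  assumes "kills a (Suc i) m" "kills b (Suc j) m"
  shows "kills (a - b) (Suc (i + j)) m"
  using assms
proof (induction "i + j" arbitrary: i j m)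
  case 0
  then show ?case by (simp add: left_diff_distrib)
next
  case (Suc k)
  have "kills (a - b) (i + j) (a * u * m)" for u
  proof (cases i)
    case 0
    then show ?thesis using Suc.prems(1) by (simp add: kills_zero)
  next
    case (Suc i')
    have "kills a (Suc i') (a * u * m)" "kills b (Suc j) (a * u * m)"
      using Suc.prems(1) Suc kills_mult_left[OF Suc.prems(2), of "a * u"] by simp_all
    then show ?thesis
      using Suc.hyps(1)[of i' j] Suc.hyps(2) Suc by simp
  qed
  moreover have "kills (a - b) (i + j) (b * u * m)" for u
  proof (cases j)
    case 0
    then show ?thesis using Suc.prems(2) by (simp add: kills_zero)
  next
    case (Suc j')
    have "kills b (Suc j') (b * u * m)" "kills a (Suc i) (b * u * m)"
      using Suc.prems(2) Suc kills_mult_left[OF Suc.prems(1), of "b * u"] by simp_all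
    then show ?thesis
      using Suc.hyps(1)[of i j'] Suc.hyps(2) Suc by simp
  qed
  ultimately show ?case
    by (simp add: left_diff_distrib kills_diff)
qed

text \<open>Multiply \<open>m\<close> from the left by factors \<open>p * u\<close> as long as a
  nonzero product remains. This ends after fewer than \<open>n\<close> factors, and the last nonzero
  product is the multiple sought.\<close>

lemma kills_imp_annihilated_multiple:
  fixes e p m :: "'b::ring"
  assumes "is_identity e" "kills p n m" "m \<noteq> 0"
  shows "\<exists>v. v * m \<noteq> 0 \<and> (\<forall>u. p * u * (v * m) = 0)"
  using assms(2,3)
proof (induction n arbitrary: m)
  case (Suc n)
  show ?case
  proof (cases "\<forall>u. p * u * m = 0")
    case True
    then show ?thesis
      using assms(1) Suc.prems(2) unfolding is_identity_def by (intro exI[of _ e]) simp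
  next
    case False
    then obtain u where "p * u * m \<noteq> 0" by blast
    then obtain v where "v * (p * u * m) \<noteq> 0" "\<forall>w. p * w * (v * (p * u * m)) = 0"
      using Suc by fastforce
    then show ?thesis
      by (intro exI[of _ "v * (p * u)"]) (simp add: mult.assoc)
  qed
qed simp

section \<open>From anticommuting elements to killing words\<close>

lemma mixed_word_zero:
  fixes h f :: "'b::ring"
  assumes "\<And>b::'b. b + b = 0 \<Longrightarrow> b = 0" "\<And>z. h * z * f + f * z * h = 0"
  shows "h * u * h * v * f = 0"
proof -
  \<comment> \<open>Exchanging \<open>f\<close> with the outer \<open>h\<close> costs one sign.
    Exchanging it with the inner \<open>h\<close> and then with the outer one gives the same word
    with two signs, so the word equals its own negative.\<close>
  have "h * (u * h * v) * f + f * (u * h * v) * h = 0"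
    by (rule assms(2))
  moreover have "h * u * (h * v * f + f * v * h) = 0" "(h * u * f + f * u * h) * v * h = 0"
    using assms(2) by simp_all
  ultimately have "h * u * h * v * f = - (f * u * h * v * h)"
    "h * u * h * v * f = - (h * u * f * v * h)" "h * u * f * v * h = - (f * u * h * v * h)"
    by (simp_all add: eq_neg_iff_add_eq_0 distrib_left distrib_right mult.assoc)
  then have "h * u * h * v * f + h * u * h * v * f = 0"
    by (metis minus_minus add.right_inverse)
  then show ?thesis by (rule assms(1))
qed

text \<open>In the part of \<open>zero\<close> linear in \<open>w\<close>, the terms ending in
  \<open>f x\<close> vanish once another \<open>h x\<close> stands on the left. What remains has
  three letters \<open>h x\<close> before \<open>f w\<close>.\<close>

lemma linearized_word:
  fixes h f :: "'a::ring \<Rightarrow> 'b::ring"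
  assumes tf: "\<And>b::'b. b + b = 0 \<Longrightarrow> b = 0"
    and add: "\<And>x y. h (x + y) = h x + h y" "\<And>x y. f (x + y) = f x + f y"
    and zero: "\<And>x u v. h x * u * h x * v * f x = 0"
  shows "kills (h x) (Suc (Suc (Suc 0))) (f w)"
proof -
  have diff: "h (x - y) = h x - h y" "f (x - y) = f x - f y" for x y
    using add[of "x - y" y] by simp_all
  have "h x * u * h x * v * f w + h x * u * h w * v * f x + h w * u * h x * v * f x = 0" for u v
  proof (rule tf)
    show "(h x * u * h x * v * f w + h x * u * h w * v * f x + h w * u * h x * v * f x) +
      (h x * u * h x * v * f w + h x * u * h w * v * f x + h w * u * h x * v * f x) = 0"
      (is "?l = 0")
    proof -
      \<comment> \<open>The values at \<open>x + w\<close> and \<open>x - w\<close> differ by twice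
        the linear and cubic parts in \<open>w\<close>; the cubic part is the value at
        \<open>w\<close>.\<close>
      have "?l = h (x + w) * u * h (x + w) * v * f (x + w)
        - h (x - w) * u * h (x - w) * v * f (x - w)
        - h w * u * h w * v * f w - h w * u * h w * v * f w"
        unfolding add diff by (simp add: algebra_simps)
      then show ?thesis by (simp only: zero) simp
    qed
  qed
  then have "h x * s * (h x * u * h x * v * f w + h x * u * h w * v * f x
      + h w * u * h x * v * f x) = 0" for s u v
    by simp
  moreover have "h x * s * (h x * u * h w * v * f x) = 0" for s u v
    using zero[of x s "u * h w * v"] by (simp add: mult.assoc)
  moreover have "h x * s * (h w * u * h x * v * f x) = 0" for s u v
    using zero[of x "s * h w * u" v] by (simp add: mult.assoc)
  ultimately show ?thesis
    by (simp add: distrib_left mult.assoc)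
qed

text \<open>Linearizing in the second argument gives three letters before \<open>f x w\<close>.
  Freeing the first argument takes five more, as \<open>h x y\<close> is a difference of two
  letters, each killing in three steps.\<close>

lemma kills_biadditive:
  fixes h f :: "'a::ring \<Rightarrow> 'a \<Rightarrow> 'b::ring"
  assumes tf: "\<And>b::'b. b + b = 0 \<Longrightarrow> b = 0"
    and h: "\<And>x y z. h (x + y) z = h x z + h y z" "\<And>x y z. h x (y + z) = h x y + h x z"
    and f: "\<And>x y z. f (x + y) z = f x z + f y z" "\<And>x y z. f x (y + z) = f x y + f x z"
    and anti: "\<And>x y b. h x y * b * f x y + f x y * b * h x y = 0"
  shows "\<exists>n. kills (h x y) n (f z w)"
proof -
  have k3: "kills (h x y) (Suc (Suc (Suc 0))) (f x w)" for x y w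
    using tf h(2) f(2) mixed_word_zero[OF tf anti] by (rule linearized_word)
  \<comment> \<open>Since three letters kill \<open>f x w\<close>, \<open>?m\<close> is a left
    multiple of \<open>f (x + z) w\<close> as well as of \<open>f z w\<close>.\<close>
  have "kills (h x y) (Suc (Suc (Suc 0) + Suc (Suc 0))) (h x y * u * (h x y * v * (h x y * s * f z w)))"
    (is "kills _ _ ?m") for u v s
  proof -
    have "h x y * u * (h x y * v * (h x y * s * f x w)) = 0"
      using k3[of x y w] by simp
    then have "?m = h x y * u * (h x y * v * (h x y * s * f (x + z) w))"
      by (simp add: f distrib_left)
    then have "kills (h (x + z) y) (Suc (Suc (Suc 0))) ?m"
      using k3[of "x + z" y w] kills_mult_left by metis
    moreover have "kills (h z y) (Suc (Suc (Suc 0))) ?m"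
      using k3[of z y w] kills_mult_left by metis
    moreover have "h x y = h (x + z) y - h z y"
      by (simp add: h)
    ultimately show ?thesis
      using kills_diff_letter by metis
  qed
  then have "kills (h x y) (Suc (Suc (Suc (Suc (Suc (Suc 0) + Suc (Suc 0)))))) (f z w)"
    by (auto simp only: kills.simps(2))
  then show ?thesis ..
qed

section \<open>Jordan maps on triple products and on the identity\<close>

locale jordan_map =
  fixes \<phi> :: "'a::ring \<Rightarrow> 'b::ring"
  assumes add: "\<phi> (x + y) = \<phi> x + \<phi> y"
    and jordan: "\<phi> (x * y + y * x) = \<phi> x * \<phi> y + \<phi> y * \<phi> x"
    and torsion_free: "b + b = 0 \<Longrightarrow> b = (0::'b)"
begin

lemma diff: "\<phi> (x - y) = \<phi> x - \<phi> y"
  using add[of "x - y" y] by simp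

lemma double_cancel: "a + a = b + b \<Longrightarrow> a = (b::'b)"
  using torsion_free[of "a - b"] by (simp add: algebra_simps)

lemma triple: "\<phi> (x * y * x) = \<phi> x * \<phi> y * \<phi> x"
proof (rule double_cancel)
  have sq: "\<phi> (x * x) = \<phi> x * \<phi> x"
    by (rule double_cancel) (use jordan[of x x] in \<open>simp add: add\<close>)
  \<comment> \<open>Twice \<open>x * y * x\<close> is a combination of iterated Jordan
    products.\<close>
  have "x * y * x + x * y * x
      = (x * (x * y + y * x) + (x * y + y * x) * x) - ((x * x) * y + y * (x * x))"
    by (simp add: algebra_simps)
  then have "\<phi> (x * y * x + x * y * x) = (\<phi> x * (\<phi> x * \<phi> y + \<phi> y * \<phi> x)
      + (\<phi> x * \<phi> y + \<phi> y * \<phi> x) * \<phi> x) - ((\<phi> x * \<phi> x) * \<phi> y + \<phi> y * (\<phi> x * \<phi> x))"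
    by (simp only: diff jordan sq)
  then show "\<phi> (x * y * x) + \<phi> (x * y * x) = \<phi> x * \<phi> y * \<phi> x + \<phi> x * \<phi> y * \<phi> x"
    by (simp add: add algebra_simps)
qed

lemma triple_sym: "\<phi> (x * y * z + z * y * x) = \<phi> x * \<phi> y * \<phi> z + \<phi> z * \<phi> y * \<phi> x"
proof -
  have "x * y * z + z * y * x = (x + z) * y * (x + z) - x * y * x - z * y * z"
    by (simp add: algebra_simps)
  then show ?thesis
    by (simp only: diff triple add) (simp add: algebra_simps)
qed

lemma identity_image:
  assumes "surj \<phi>" "is_identity e"
  shows "is_identity (\<phi> e)"
proof -
  let ?u = "\<phi> e"
  have two: "?u * b + b * ?u = b + b" for b
  proof -
    obtain x where "b = \<phi> x" using assms(1) by (metis surjD)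
    then show ?thesis
      using jordan[of e x] assms(2) by (simp add: add is_identity_def)
  qed
  have idem: "?u * ?u = ?u"
    using two[of ?u] by (rule double_cancel)
  \<comment> \<open>Multiplying \<open>two\<close> by the idempotent \<open>?u\<close> from either
    side.\<close>
  have "?u * b = ?u * b * ?u" "b * ?u = ?u * b * ?u" for b
  proof -
    have "?u * (?u * b + b * ?u) = ?u * (b + b)" "(?u * b + b * ?u) * ?u = (b + b) * ?u"
      by (simp_all only: two)
    moreover have "?u * (?u * b) = ?u * b" "b * ?u * ?u = b * ?u"
      using idem by (metis mult.assoc)+
    ultimately show "?u * b = ?u * b * ?u" "b * ?u = ?u * b * ?u"
      by (simp_all add: distrib_left distrib_right mult.assoc)
  qed
  then have "?u * b = b * ?u" for b by metis
  then show ?thesis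
    using two double_cancel unfolding is_identity_def by metis
qed

section \<open>Defects of multiplicativity\<close>

definition hom_defect :: "'a \<Rightarrow> 'a \<Rightarrow> 'b" where
  "hom_defect x y = \<phi> (x * y) - \<phi> x * \<phi> y"

definition antihom_defect :: "'a \<Rightarrow> 'a \<Rightarrow> 'b" where
  "antihom_defect x y = \<phi> (x * y) - \<phi> y * \<phi> x"

lemma hom_defect_add:
  "hom_defect (x + y) z = hom_defect x z + hom_defect y z"
  "hom_defect x (y + z) = hom_defect x y + hom_defect x z"
  by (simp_all add: hom_defect_def add algebra_simps)

lemma antihom_defect_add:
  "antihom_defect (x + y) z = antihom_defect x z + antihom_defect y z"
  "antihom_defect x (y + z) = antihom_defect x y + antihom_defect x z"
  by (simp_all add: antihom_defect_def add algebra_simps)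

lemma image_commutator: "\<phi> (x * y - y * x) = hom_defect x y + antihom_defect x y"
  using jordan[of x y] by (simp add: hom_defect_def antihom_defect_def diff add algebra_simps)

text \<open>The image of \<open>(x * y) * z * (y * x) + (y * x) * z * (x * y)\<close> is computed in
  two ways: by \<open>triple_sym\<close>, and by \<open>triple\<close> after regrouping.\<close>

lemma defects_anticommute:
  assumes "surj \<phi>"
  shows "antihom_defect x y * b * hom_defect x y + hom_defect x y * b * antihom_defect x y = 0"
proof -
  obtain z where b: "b = \<phi> z" using assms by (metis surjD)
  define p q s t where "p = \<phi> (x * y)" and "q = \<phi> (y * x)"
    and "s = \<phi> x * \<phi> y" and "t = \<phi> y * \<phi> x"
  have pq: "p + q = s + t"
    using jordan[of x y] by (simp add: p_def q_def s_def t_def add)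
  have "(x * y) * z * (y * x) + (y * x) * z * (x * y)
      = x * (y * z * y) * x + y * (x * z * x) * y"
    by (simp add: mult.assoc)
  then have "p * b * q + q * b * p = \<phi> (x * (y * z * y) * x + y * (x * z * x) * y)"
    by (simp only: p_def q_def b flip: triple_sym)
  also have "\<dots> = \<phi> x * (\<phi> y * \<phi> z * \<phi> y) * \<phi> x + \<phi> y * (\<phi> x * \<phi> z * \<phi> x) * \<phi> y"
    by (simp only: add triple)
  also have "\<dots> = s * b * t + t * b * s"
    by (simp add: s_def t_def b mult.assoc)
  finally have pbq: "p * b * q + q * b * p = s * b * t + t * b * s" .
  \<comment> \<open>Writing the hom defect as \<open>t - q\<close> rather than \<open>p - s\<close>
    leaves only \<open>p + q\<close> and the symmetric term of \<open>pbq\<close> in the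
    expansion.\<close>
  have defects: "antihom_defect x y = p - t" "hom_defect x y = t - q"
    using pq by (simp_all add: antihom_defect_def hom_defect_def p_def q_def s_def t_def algebra_simps)
  have "antihom_defect x y * b * hom_defect x y + hom_defect x y * b * antihom_defect x y
      = (p + q) * b * t + t * b * (p + q) - (p * b * q + q * b * p) - (t * b * t + t * b * t)"
    unfolding defects by (simp add: algebra_simps)
  also have "\<dots> = 0"
    unfolding pq pbq by (simp add: algebra_simps)
  finally show ?thesis .
qed

text \<open>Modulo \<open>E\<close> the map is multiplicative and sends commutators, whose images
  are sums of defects, to 0. So the preimage of \<open>E\<close> is an ideal containing
  \<open>K(A)\<close>; scaling in \<open>A\<close> is multiplication by
  \<open>sA c e\<close>.\<close>

lemma preimage_ideal_UNIV:
  fixes sA :: "'f::field \<Rightarrow> 'a \<Rightarrow> 'a" and e :: 'a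
  assumes alg: "assoc_algebra sA" and perfect: "commutator_ideal sA = UNIV"
    and e: "is_identity e"
    and E: "0 \<in> E" "\<And>a b. a \<in> E \<Longrightarrow> b \<in> E \<Longrightarrow> a + b \<in> E"
      "\<And>a b. b \<in> E \<Longrightarrow> a * b \<in> E \<and> b * a \<in> E"
    and defects: "\<And>x y. hom_defect x y \<in> E" "\<And>x y. antihom_defect x y \<in> E"
  shows "\<phi> x \<in> E"
proof -
  let ?J = "{a. \<phi> a \<in> E}"
  have mult: "a * x \<in> ?J \<and> x * a \<in> ?J" if "x \<in> ?J" for a x
  proof -
    have "\<phi> (a * x) = hom_defect a x + \<phi> a * \<phi> x" "\<phi> (x * a) = hom_defect x a + \<phi> x * \<phi> a"
      by (simp_all add: hom_defect_def)
    then show ?thesis using that E defects by simp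
  qed
  interpret A: assoc_algebra sA by (rule alg)
  have "sA c x \<in> ?J" if "x \<in> ?J" for c x
  proof -
    have "sA c x = sA c e * x"
      using e by (simp add: A.scale_mult_left is_identity_def)
    then show ?thesis using mult[OF that] by simp
  qed
  moreover have "\<phi> 0 = 0" using add[of 0 0] by simp
  ultimately have "algebra_ideal sA ?J"
    using mult E by (auto simp: algebra_ideal_def A.subspace_def add)
  moreover have "{x * y - y * x | x y. True} \<subseteq> ?J"
    using defects E(2) by (auto simp: image_commutator)
  ultimately have "commutator_ideal sA \<subseteq> ?J"
    unfolding commutator_ideal_def by (intro hull_minimal)
  then show ?thesis using perfect by auto
qed

section \<open>Orthogonality of the two kinds of defects\<close>

lemma defects_orthogonal:
  fixes sA :: "'f::field \<Rightarrow> 'a \<Rightarrow> 'a" and e :: 'a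
  assumes alg: "assoc_algebra sA" and perfect: "commutator_ideal sA = UNIV"
    and e: "is_identity e" and surj: "surj \<phi>"
  shows "antihom_defect a b * z * hom_defect p q = 0"
    and "hom_defect a b * z * antihom_defect p q = 0"
proof -
  have u: "is_identity (\<phi> e)"
    using surj e by (rule identity_image)
  have zero: "m = 0"
    if m: "m \<in> X" and X: "\<And>v m. m \<in> X \<Longrightarrow> v * m \<in> X"
      and kills: "\<And>m x y. m \<in> X \<Longrightarrow> \<exists>n. kills (hom_defect x y) n m"
        "\<And>m x y. m \<in> X \<Longrightarrow> \<exists>n. kills (antihom_defect x y) n m" for X m
  proof -
    \<comment> \<open>Every defect lies in \<open>E\<close> because it kills the elements of
      \<open>X\<close>. Once \<open>\<phi> e\<close> lies in \<open>E\<close>, a nonzero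
      \<open>m\<close> would have a nonzero multiple annihilated by the identity.\<close>
    define E where "E = {b. \<forall>m\<in>X. m \<noteq> 0 \<longrightarrow> (\<exists>v. v * m \<noteq> 0 \<and> (\<forall>w. b * w * (v * m) = 0))}"
    have "\<phi> e \<in> E"
      using alg perfect e
    proof (rule preimage_ideal_UNIV)
      show "0 \<in> E"
        using u unfolding E_def is_identity_def by (auto intro: exI[of _ "\<phi> e"])
    next
      fix b c assume b: "b \<in> E" and c: "c \<in> E"
      show "b + c \<in> E"
        unfolding E_def
      proof (intro CollectI ballI impI)
        fix m assume "m \<in> X" "m \<noteq> 0"
        then obtain v where v: "v * m \<noteq> 0" "\<forall>w. b * w * (v * m) = 0"
          using b unfolding E_def by blast
        \<comment> \<open>The condition on \<open>c\<close> is applied to \<open>v * m\<close>,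
          again a nonzero element of \<open>X\<close>; for \<open>b\<close>, the new factor
          \<open>v'\<close> is absorbed into \<open>w\<close>.\<close>
        then obtain v' where v': "v' * (v * m) \<noteq> 0" "\<forall>w. c * w * (v' * (v * m)) = 0"
          using c X[OF \<open>m \<in> X\<close>] unfolding E_def by blast
        have "b * w * (v' * (v * m)) = 0" for w
          using v(2)[rule_format, of "w * v'"] by (simp add: mult.assoc)
        then show "\<exists>v. v * m \<noteq> 0 \<and> (\<forall>w. (b + c) * w * (v * m) = 0)"
          using v' by (intro exI[of _ "v' * v"]) (simp add: distrib_right mult.assoc)
      qed
    next
      fix a b assume "b \<in> E"
      then show "a * b \<in> E \<and> b * a \<in> E"
        unfolding E_def by (simp add: mult.assoc) (metis mult.assoc mult_zero_right)
    next
      show "hom_defect x y \<in> E" "antihom_defect x y \<in> E" for x y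
        unfolding E_def using kills kills_imp_annihilated_multiple[OF u] by blast+
    qed
    then show "m = 0"
      using m u unfolding E_def is_identity_def by (auto) metis
  qed
  have anti: "hom_defect x y * b * antihom_defect x y + antihom_defect x y * b * hom_defect x y = 0"
    for x y b
    using defects_anticommute[OF surj, of x y b] by (simp add: add.commute)
  have kills: "\<exists>n. kills (antihom_defect x y) n (hom_defect z w)"
    "\<exists>n. kills (hom_defect x y) n (antihom_defect z w)" for x y z w
    using kills_biadditive[OF torsion_free antihom_defect_add hom_defect_add
        defects_anticommute[OF surj]]
      kills_biadditive[OF torsion_free hom_defect_add antihom_defect_add anti] by blast+
  \<comment> \<open>A product is killed as soon as one factor is. With one defect of each kind as
    factors, letters of both kinds kill it.\<close>
  have kills_factor: "\<exists>n. kills p n m"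
    if "m \<in> {u * (l * z * r) | u. True}" "(\<exists>n. kills p n l) \<or> (\<exists>n. kills p n r)" for p l r m :: 'b
    using that by (auto intro: kills_mult_left kills_mult_right)
  have left_closed: "v * m \<in> {u * r | u. True}" if "m \<in> {u * r | u. True}" for v m r :: 'b
    using that by (auto intro: mult.assoc[symmetric])
  have 1: "b \<in> {u * b | u. True}" for b :: 'b
    using u unfolding is_identity_def by (metis (mono_tags, lifting) mem_Collect_eq)
  show "antihom_defect a b * z * hom_defect p q = 0"
    using 1 left_closed
  proof (rule zero)
    fix m x y assume m: "m \<in> {u * (antihom_defect a b * z * hom_defect p q) | u. True}"
    show "\<exists>n. kills (hom_defect x y) n m" "\<exists>n. kills (antihom_defect x y) n m"
      by (rule kills_factor[OF m], use kills in simp)+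
  qed
  show "hom_defect a b * z * antihom_defect p q = 0"
    using 1 left_closed
  proof (rule zero)
    fix m x y assume m: "m \<in> {u * (hom_defect a b * z * antihom_defect p q) | u. True}"
    show "\<exists>n. kills (hom_defect x y) n m" "\<exists>n. kills (antihom_defect x y) n m"
      by (rule kills_factor[OF m], use kills in simp)+
  qed
qed

end

section \<open>Splitting \<open>B\<close> into two ideals that annihilate each other\<close>

text \<open>The middle factor \<open>u\<close> yields a two-sided ideal for any set
  \<open>S\<close>; demanding both orders puts \<open>S\<close> into its double annihilator.\<close>

definition annihilator :: "'b::ring set \<Rightarrow> 'b set" where
  "annihilator S = {b. \<forall>s\<in>S. \<forall>u. b * u * s = 0 \<and> s * u * b = 0}"

lemma annihilator_ideal:
  "0 \<in> annihilator S"
  "a \<in> annihilator S \<Longrightarrow> b \<in> annihilator S \<Longrightarrow> a + b \<in> annihilator S"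
  "b \<in> annihilator S \<Longrightarrow> a * b \<in> annihilator S \<and> b * a \<in> annihilator S"
  unfolding annihilator_def by (auto simp: distrib_left distrib_right)
    (metis mult.assoc mult_zero_left mult_zero_right)+

context jordan_map
begin

lemma central_idempotent:
  fixes sA :: "'f::field \<Rightarrow> 'a \<Rightarrow> 'a" and e :: 'a
  assumes alg: "assoc_algebra sA" and perfect: "commutator_ideal sA = UNIV"
    and e: "is_identity e" and surj: "surj \<phi>"
  shows "\<exists>\<epsilon>\<in>ring_center. \<epsilon> * \<epsilon> = \<epsilon> \<and>
    (\<forall>x y. \<epsilon> * hom_defect x y = 0 \<and> (\<phi> e - \<epsilon>) * antihom_defect x y = 0)"
proof -
  note orth = defects_orthogonal[OF alg perfect e surj]
  have u: "\<phi> e * b = b" "b * \<phi> e = b" for b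
    using identity_image[OF surj e] unfolding is_identity_def by blast+
  define H where "H = annihilator (range (\<lambda>(x, y). hom_defect x y))"
  define G where "G = annihilator H"
  have H_defect: "antihom_defect x y \<in> H" for x y
    unfolding H_def annihilator_def using orth by auto
  have G_defect: "hom_defect x y \<in> G" for x y
    unfolding G_def H_def annihilator_def by auto
  have GH: "a * v * b = 0" "b * v * a = 0" if "a \<in> G" "b \<in> H" for a b v
    using that unfolding G_def annihilator_def by blast+
  have GH': "a * b = 0" "b * a = 0" if "a \<in> G" "b \<in> H" for a b
    using GH[OF that, of "\<phi> e"] by (simp_all add: u)
  define E where "E = {a + b | a b. a \<in> G \<and> b \<in> H}"
  have "\<phi> e \<in> E"
    using alg perfect e
  proof (rule preimage_ideal_UNIV)
    show "0 \<in> E"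
      unfolding E_def G_def H_def using annihilator_ideal(1) by force
    show "hom_defect x y \<in> E" "antihom_defect x y \<in> E" for x y
      using G_defect[of x y] H_defect[of x y] annihilator_ideal(1)[of H]
        annihilator_ideal(1)[of "range (\<lambda>(x, y). hom_defect x y)"]
      unfolding E_def G_def[symmetric] H_def[symmetric] by force+
  next
    fix b c assume "b \<in> E" "c \<in> E"
    then obtain b1 b2 c1 c2 where "b = b1 + b2" "c = c1 + c2" "b1 \<in> G" "c1 \<in> G" "b2 \<in> H" "c2 \<in> H"
      unfolding E_def by blast
    then have "b + c = (b1 + c1) + (b2 + c2)" "b1 + c1 \<in> G" "b2 + c2 \<in> H"
      by (simp_all add: G_def H_def annihilator_ideal(2))
    then show "b + c \<in> E" unfolding E_def by blast
  next
    fix a b assume "b \<in> E"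
    then obtain b1 b2 where "b = b1 + b2" "b1 \<in> G" "b2 \<in> H"
      unfolding E_def by blast
    then have "a * b = a * b1 + a * b2" "b * a = b1 * a + b2 * a"
      "a * b1 \<in> G" "b1 * a \<in> G" "a * b2 \<in> H" "b2 * a \<in> H"
      by (simp_all add: G_def H_def annihilator_ideal(3) distrib_left distrib_right)
    then show "a * b \<in> E \<and> b * a \<in> E" unfolding E_def by blast
  qed
  then obtain g k where gk: "\<phi> e = g + k" "g \<in> G" "k \<in> H"
    unfolding E_def by blast
  have split: "b = g * b + k * b" "b = b * g + b * k" for b
    using u[of b] by (simp_all add: gk(1) distrib_left distrib_right)
  \<comment> \<open>Insert \<open>g + k\<close> for the identity to the right of
    \<open>k * b\<close> and to the left of \<open>b * k\<close>; the \<open>g\<close> terms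
    vanish.\<close>
  have "k * b = k * b * k" "b * k = k * b * k" for b
    using split(2)[of "k * b"] split(1)[of "b * k"]
    by (simp_all only: GH[OF gk(2,3)] add_0 flip: mult.assoc)
  then have "k \<in> ring_center"
    unfolding ring_center_def by auto
  moreover have "k * k = k"
    using split(1)[of k] GH'[OF gk(2,3)] by simp
  moreover have "k * hom_defect x y = 0" for x y
    using GH'(2)[OF G_defect gk(3)] .
  moreover have "(\<phi> e - k) * antihom_defect x y = 0" for x y
    using GH'(1)[OF gk(2) H_defect] by (simp add: gk(1))
  ultimately show ?thesis by blast
qed

end

section \<open>The standard decomposition from the central idempotent\<close>

theorem theorem2p10:
  fixes scaleA :: "'f::field \<Rightarrow> 'a::ring \<Rightarrow> 'a"
    and scaleB :: "'f \<Rightarrow> 'b::ring \<Rightarrow> 'b"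
    and \<phi> :: "'a \<Rightarrow> 'b"
  assumes "CHAR('f) \<noteq> 2"
    and "assoc_algebra scaleA"
    and "\<exists>e::'a. is_identity e"
    and "commutator_ideal scaleA = UNIV"
    and "assoc_algebra scaleB"
    and "jordan_hom scaleA scaleB \<phi>"
    and "surj \<phi>"
  shows "standard_jordan_hom scaleA scaleB \<phi> \<and>
    (\<exists>u::'b. is_identity u \<and>
      (\<exists>\<epsilon>\<in>ring_center. \<epsilon> * \<epsilon> = \<epsilon> \<and>
        algebra_hom scaleA scaleB (\<lambda>x. \<epsilon> * \<phi> x) \<and>
        algebra_antihom scaleA scaleB (\<lambda>x. (u - \<epsilon>) * \<phi> x)))"
proof -
  interpret B: assoc_algebra scaleB by (rule assms(5))
  have lin: "Vector_Spaces.linear scaleA scaleB \<phi>"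
    using assms(6) unfolding jordan_hom_def by blast
  interpret L: Vector_Spaces.linear scaleA scaleB \<phi> by (rule lin)
  \<comment> \<open>The characteristic is neither 1 nor 2.\<close>
  have "\<not> CHAR('f) dvd 2"
    using assms(1) CHAR_not_1 by (metis dvd_imp_le le_SucE le_zero_eq numeral_2_eq_2 dvd_0_left_iff zero_less_numeral)
  then have two: "(1::'f) + 1 \<noteq> 0"
    using of_nat_eq_0_iff_char_dvd[where 'a = 'f, of 2] by simp
  interpret jordan_map \<phi>
  proof
    show "\<phi> (x + y) = \<phi> x + \<phi> y" for x y by (rule L.add)
    show "\<phi> (x * y + y * x) = \<phi> x * \<phi> y + \<phi> y * \<phi> x" for x y
      using assms(6) unfolding jordan_hom_def jordan_prod_def by blast
    show "b = 0" if "b + b = 0" for b :: 'b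
    proof -
      have "scaleB (1 + 1) b = 0"
        using that by (simp only: B.scale_left_distrib B.scale_one)
      then show ?thesis using two by simp
    qed
  qed
  obtain e where e: "is_identity (e::'a)" using assms(3) by blast
  define u where "u = \<phi> e"
  have u: "is_identity u"
    unfolding u_def using assms(7) e by (rule identity_image)
  obtain \<epsilon> where \<epsilon>: "\<epsilon> \<in> ring_center" "\<epsilon> * \<epsilon> = \<epsilon>" "\<And>x y. \<epsilon> * hom_defect x y = 0"
    "\<And>x y. (u - \<epsilon>) * antihom_defect x y = 0"
    using central_idempotent[OF assms(2,4) e assms(7)] unfolding u_def by blast
  have u': "u * b = b" "b * u = b" for b
    using u unfolding is_identity_def by blast+
  let ?\<eta> = "u - \<epsilon>"
  have central: "\<epsilon> * b = b * \<epsilon>" "?\<eta> * b = b * ?\<eta>" for b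
    using \<epsilon>(1) unfolding ring_center_def by (simp_all add: left_diff_distrib right_diff_distrib u')
  have idem: "?\<eta> * ?\<eta> = ?\<eta>" "\<epsilon> * ?\<eta> = 0" "?\<eta> * \<epsilon> = 0"
    using \<epsilon>(2) by (simp_all add: left_diff_distrib right_diff_distrib u')
  \<comment> \<open>Central factors move to the left, where \<open>idem\<close> or
    \<open>\<epsilon> * \<epsilon> = \<epsilon>\<close> collapses them.\<close>
  have mult: "p * b * (\<epsilon> * c) = p * \<epsilon> * (b * c)" "p * b * (?\<eta> * c) = p * ?\<eta> * (b * c)" for p b c
    by (metis central mult.assoc)+
  have linear_mult: "Vector_Spaces.linear scaleA scaleB (\<lambda>x. c * \<phi> x)" for c
    by unfold_locales (simp_all add: L.add L.scale distrib_left B.scale_mult_right)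
  have hom: "algebra_hom scaleA scaleB (\<lambda>x. \<epsilon> * \<phi> x)"
    unfolding algebra_hom_def
    using linear_mult \<epsilon>(3) by (simp add: hom_defect_def right_diff_distrib mult \<epsilon>(2))
  have antihom: "algebra_antihom scaleA scaleB (\<lambda>x. ?\<eta> * \<phi> x)"
    unfolding algebra_antihom_def
  proof (intro conjI allI)
    show "?\<eta> * \<phi> (x * y) = ?\<eta> * \<phi> y * (?\<eta> * \<phi> x)" for x y
      using \<epsilon>(4)[of x y]
      by (simp only: antihom_defect_def right_diff_distrib[of ?\<eta> "\<phi> (x * y)"] mult idem right_minus_eq)
  qed (rule linear_mult)
  have "\<phi> x = \<epsilon> * \<phi> x + ?\<eta> * \<phi> x" for x
    by (simp add: left_diff_distrib u')
  moreover have "\<epsilon> * \<phi> x * (?\<eta> * \<phi> y) = 0 \<and> ?\<eta> * \<phi> x * (\<epsilon> * \<phi> y) = 0" for x y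
    by (simp only: mult idem mult_zero_left simp_thms)
  ultimately have "standard_jordan_hom scaleA scaleB \<phi>"
    unfolding standard_jordan_hom_def using assms(6) hom antihom
    by (intro conjI exI[of _ "\<lambda>x. \<epsilon> * \<phi> x"] exI[of _ "\<lambda>x. (u - \<epsilon>) * \<phi> x"]) auto
  then show ?thesis
    using u \<epsilon>(1,2) hom antihom by blast
qed

end
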